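(* Let $k\in\{0,1,2,3\}$ and let $G$ be a $k$-connected graph in which two (distinct) vertices are connected by $k+1$ edge-disjoint paths. Then there are two (distinct) vertices in $G$ that are connected by $k+1$ independent paths.
   Context: All graphs are finite, undirected and loopless, but may contain parallel edges. Paths using different parallel edges are different paths (in particular, two parallel edges joining $v$ and $w$ give two different $v$-$w$ paths). A graph $G$ is $k$-connected ($k\in\mathbb{N}$, $0\in\mathbb N$) if $|V(G)|\ge k+1$ and $G-S$ is connected for every set $S\subseteq V(G)$ with $|S|\le k-1$. Two or more (distinct) paths are independent if every vertex contained in more than one of the paths is an endpoint of all the paths it is contained in. *)

theory Defs
  imports "HOL-Library.Disjoint_Sets"
begin

record ('v, 'e) pre_multigraph =
  verts :: "'v set"
  edges :: "'e set"
  ends :: "'e \<Rightarrow> 'v set"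

text \<open>
  Finite undirected loopless graphs with parallel edges: edges are objects of their own, and
  parallel edges are distinct edges with the same set of ends. Requiring exactly two ends
  excludes loops.
\<close>
locale multigraph =
  fixes G :: "('v, 'e) pre_multigraph" (structure)
  assumes finite_verts: "finite (verts G)"
    and finite_edges: "finite (edges G)"
    and ends_subset: "e \<in> edges G \<Longrightarrow> ends G e \<subseteq> verts G"
    and card_ends: "e \<in> edges G \<Longrightarrow> card (ends G e) = 2"

text \<open>
  A path is given by the list of its vertices and the list of its edges, in order of traversal,
  so that paths through different parallel edges differ. The list representation also
  distinguishes a path from its reversal, but for distinct \<open>x\<close> and \<open>y\<close> each path
  between \<open>x\<close> and \<open>y\<close> has exactly one representation that starts in \<open>x\<close>.
\<close>
type_synonym ('v, 'e) path = "'v list \<times> 'e list"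

definition path_verts :: "('v, 'e) path \<Rightarrow> 'v set" where
  "path_verts p = set (fst p)"

definition path_edges :: "('v, 'e) path \<Rightarrow> 'e set" where
  "path_edges p = set (snd p)"

definition path_endpoints :: "('v, 'e) path \<Rightarrow> 'v set" where
  "path_endpoints p = {hd (fst p), last (fst p)}"

definition is_path :: "('v, 'e) pre_multigraph \<Rightarrow> ('v, 'e) path \<Rightarrow> bool" where
  "is_path G p \<longleftrightarrow>
     length (fst p) = Suc (length (snd p)) \<and>
     distinct (fst p) \<and>
     path_verts p \<subseteq> verts G \<and>
     path_edges p \<subseteq> edges G \<and>
     (\<forall>i < length (snd p). ends G (snd p ! i) = {fst p ! i, fst p ! Suc i})"

definition is_path_between :: "('v, 'e) pre_multigraph \<Rightarrow> 'v \<Rightarrow> ('v, 'e) path \<Rightarrow> 'v \<Rightarrow> bool" where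
  "is_path_between G x p y \<longleftrightarrow> is_path G p \<and> hd (fst p) = x \<and> last (fst p) = y"

definition connected_graph :: "('v, 'e) pre_multigraph \<Rightarrow> bool" where
  "connected_graph G \<longleftrightarrow>
     verts G \<noteq> {} \<and> (\<forall>x \<in> verts G. \<forall>y \<in> verts G. \<exists>p. is_path_between G x p y)"

definition delete_verts :: "('v, 'e) pre_multigraph \<Rightarrow> 'v set \<Rightarrow> ('v, 'e) pre_multigraph" where
  "delete_verts G S =
     \<lparr>verts = verts G - S, edges = {e \<in> edges G. ends G e \<inter> S = {}}, ends = ends G\<rparr>"

text \<open>
  The bound \<open>card S \<le> k - 1\<close> is meant over the integers (for \<open>k = 0\<close> no \<open>S\<close> satisfies it),
  hence \<open>card S < k\<close>.
\<close>
definition k_connected :: "nat \<Rightarrow> ('v, 'e) pre_multigraph \<Rightarrow> bool" where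
  "k_connected k G \<longleftrightarrow>
     card (verts G) \<ge> k + 1 \<and>
     (\<forall>S. S \<subseteq> verts G \<and> card S < k \<longrightarrow> connected_graph (delete_verts G S))"

definition edge_disjoint :: "('v, 'e) path set \<Rightarrow> bool" where
  "edge_disjoint P \<longleftrightarrow> disjoint_family_on path_edges P"

definition independent :: "('v, 'e) path set \<Rightarrow> bool" where
  "independent P \<longleftrightarrow>
     (\<forall>v. (\<exists>p \<in> P. \<exists>q \<in> P. p \<noteq> q \<and> v \<in> path_verts p \<and> v \<in> path_verts q) \<longrightarrow>
          (\<forall>p \<in> P. v \<in> path_verts p \<longrightarrow> v \<in> path_endpoints p))"

definition connected_by_edge_disjoint_paths ::
    "('v, 'e) pre_multigraph \<Rightarrow> nat \<Rightarrow> 'v \<Rightarrow> 'v \<Rightarrow> bool" where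
  "connected_by_edge_disjoint_paths G n x y \<longleftrightarrow>
     (\<exists>P. finite P \<and> card P = n \<and> (\<forall>p \<in> P. is_path_between G x p y) \<and> edge_disjoint P)"

definition connected_by_independent_paths ::
    "('v, 'e) pre_multigraph \<Rightarrow> nat \<Rightarrow> 'v \<Rightarrow> 'v \<Rightarrow> bool" where
  "connected_by_independent_paths G n x y \<longleftrightarrow>
     (\<exists>P. finite P \<and> card P = n \<and> (\<forall>p \<in> P. is_path_between G x p y) \<and> independent P)"

end

theory Submission
  imports Defs
begin

text \<open>
  The idea is to forget the paths and to argue with separations: pairs \<open>(A, B)\<close> of disjoint
  vertex sets, whose order is the number of vertices outside \<open>A \<union> B\<close> plus the number of edges
  between \<open>A\<close> and \<open>B\<close>. By Menger's theorem (\<open>menger_independent_paths\<close>, proved here from Hall's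
  theorem) two vertices are joined by \<open>k + 1\<close> independent paths as soon as every separation
  between them has order above \<open>k\<close>. Connectedness of \<open>G\<close> bounds the orders of separations with
  nonempty sides from below by \<open>k\<close>, and the edge-disjoint paths bound the edge cuts between \<open>x\<close>
  and \<open>y\<close> from below by \<open>k + 1\<close>.

  Two parallel edges settle the matter at once, since their ends are joined by \<open>k + 1\<close>
  independent paths (\<open>locally_connected_if_parallel\<close>). So \<open>G\<close> may be taken to be simple. An edge
  cut of size at most \<open>k\<close> with at least two vertices on both sides does not separate \<open>x\<close> from
  \<open>y\<close>; contracting the side that contains neither of them gives a smaller graph with the same
  properties, from which the conclusion lifts back (\<open>contraction\<close>,
  \<open>locally_connected_contraction\<close>).

  If no such edge cut is left, suppose that every two vertices have a separation of order at
  most \<open>k\<close>. Among suitable separations of order at most \<open>k\<close> with vertices of degree above \<open>k\<close> on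
  both sides take \<open>(A, B)\<close> with \<open>A\<close> smallest. It is not a mere edge cut, so some vertex \<open>s\<close> lies
  outside \<open>A \<union> B\<close>. Uncrossing with a small separation between \<open>s\<close> and a vertex of \<open>A\<close> of large
  degree produces a smaller choice for \<open>A\<close>, a contradiction
  (\<open>exists_locally_connected_if_small_cuts_trivial\<close>). The hypothesis \<open>k \<le> 3\<close> enters in this
  uncrossing and in showing that contraction preserves connectedness.
\<close>

section \<open>Separations with vertices and edges\<close>

definition cross :: "('v \<Rightarrow> 'v \<Rightarrow> nat) \<Rightarrow> 'v set \<Rightarrow> 'v set \<Rightarrow> nat" where
  "cross m A B = (\<Sum>a\<in>A. \<Sum>b\<in>B. m a b)"

definition separation :: "'v set \<Rightarrow> 'v set \<Rightarrow> 'v set \<Rightarrow> bool" where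
  "separation V A B \<longleftrightarrow> A \<subseteq> V \<and> B \<subseteq> V \<and> A \<inter> B = {}"

text \<open>
  For \<open>u \<in> A\<close> and \<open>v \<in> B\<close>, the vertices outside \<open>A \<union> B\<close> together with the edges between \<open>A\<close> and
  \<open>B\<close> separate \<open>u\<close> from \<open>v\<close>. Counting both kinds in one number treats vertex cuts, edge cuts and
  mixed cuts alike: for adjacent \<open>u\<close> and \<open>v\<close> no set of vertices separates them, and for
  \<open>B = V - A\<close> the number is the size of an edge cut.
\<close>

definition sep_order :: "'v set \<Rightarrow> ('v \<Rightarrow> 'v \<Rightarrow> nat) \<Rightarrow> 'v set \<Rightarrow> 'v set \<Rightarrow> nat" where
  "sep_order V m A B = card (V - (A \<union> B)) + cross m A B"

text \<open>
  By Menger's theorem this is the existence of \<open>n\<close> independent paths between \<open>u\<close> and \<open>v\<close>.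
\<close>

definition locally_connected :: "nat \<Rightarrow> 'v set \<Rightarrow> ('v \<Rightarrow> 'v \<Rightarrow> nat) \<Rightarrow> 'v \<Rightarrow> 'v \<Rightarrow> bool" where
  "locally_connected n V m u v \<longleftrightarrow>
     (\<forall>A B. separation V A B \<longrightarrow> u \<in> A \<longrightarrow> v \<in> B \<longrightarrow> n \<le> sep_order V m A B)"

lemma separation_commute: "separation V A B \<longleftrightarrow> separation V B A"
  by (auto simp: separation_def)

text \<open>
  A multigraph is recorded here by the number \<open>m a b\<close> of edges between any two vertices, because
  the order of a separation depends on nothing else and because contracting a set of vertices
  then just adds up multiplicities. Contraction leaves edges inside the contracted set as values
  \<open>m a a\<close>, which no separation sees.
\<close>

locale multiplicities =
  fixes V :: "'v set" and m :: "'v \<Rightarrow> 'v \<Rightarrow> nat"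
  assumes finite_V: "finite V"
    and sym: "m a b = m b a"
begin

lemma finite_sub: "A \<subseteq> V \<Longrightarrow> finite A"
  using finite_V finite_subset by blast

lemma cross_commute: "cross m A B = cross m B A"
  unfolding cross_def by (subst sum.swap) (simp add: sym)

lemma cross_mono: "A \<subseteq> A' \<Longrightarrow> B \<subseteq> B' \<Longrightarrow> A' \<subseteq> V \<Longrightarrow> B' \<subseteq> V \<Longrightarrow> cross m A B \<le> cross m A' B'"
  unfolding cross_def
  by (rule order_trans[OF sum_mono[OF sum_mono2] sum_mono2]) (auto intro: finite_sub)

lemma cross_Un:
  assumes "B \<subseteq> V" "B' \<subseteq> V" "B \<inter> B' = {}"
  shows "cross m A (B \<union> B') = cross m A B + cross m A B'"
  using assms by (simp add: cross_def sum.union_disjoint finite_sub sum.distrib)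

lemma cross_singletons: "cross m A B = (\<Sum>b\<in>B. cross m {b} A)"
  by (subst cross_commute) (simp add: cross_def)

lemma order_commute: "sep_order V m A B = sep_order V m B A"
  by (simp add: sep_order_def cross_commute Un_commute)

text \<open>
  Moving a separating vertex \<open>t\<close> to the side \<open>B\<close> trades \<open>t\<close> for its edges to \<open>A\<close>. The order does
  not grow if there is at most one such edge.
\<close>

lemma order_insert:
  assumes "separation V A B" "t \<in> V - (A \<union> B)"
  shows "sep_order V m A (insert t B) + 1 = sep_order V m A B + cross m {t} A"
proof -
  have "V - (A \<union> B) = insert t (V - (A \<union> insert t B))" using assms by auto
  then have "card (V - (A \<union> B)) = card (V - (A \<union> insert t B)) + 1"
    by (metis (no_types, lifting) DiffE Suc_eq_plus1 UnI2 card_insert_disjoint finite_Diff finite_V insertI1 sup.commute)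
  moreover have "cross m A (B \<union> {t}) = cross m A B + cross m A {t}"
    using assms by (intro cross_Un) (auto simp: separation_def)
  ultimately show ?thesis by (simp add: sep_order_def cross_commute)
qed

lemma cross_indicator:
  assumes "A \<subseteq> V" "B \<subseteq> V"
  shows "cross m A B = (\<Sum>p\<in>V. \<Sum>q\<in>V. m p q * of_bool (p \<in> A \<and> q \<in> B))"
proof -
  have *: "(\<Sum>p\<in>V. f p * of_bool (p \<in> S)) = sum f S" if "S \<subseteq> V" for S and f :: "'v \<Rightarrow> nat"
    using that finite_V by (simp add: of_bool_def if_distrib sum.If_cases Int_absorb1 flip: sum.inter_restrict cong: if_cong)
  have "(\<Sum>p\<in>V. \<Sum>q\<in>V. m p q * of_bool (p \<in> A \<and> q \<in> B)) =
        (\<Sum>p\<in>V. (\<Sum>q\<in>V. m p q * of_bool (q \<in> B)) * of_bool (p \<in> A))"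
    by (intro sum.cong) (auto simp: sum_distrib_right)
  then show ?thesis using assms by (simp add: * cross_def)
qed

lemma card_indicator: "card (V - S) = (\<Sum>p\<in>V. of_bool (p \<notin> S))"
proof -
  have "V \<inter> {p. p \<notin> S} = V - S" by auto
  then show ?thesis using finite_V by (simp add: of_bool_def sum.If_cases)
qed

text \<open>
  The usual uncrossing inequality for two separations. The vertex parts on the two sides are
  equal; for the edge parts every ordered pair \<open>(p, q)\<close> contributes at least as much on the
  right. The extra term is part of the slack: an edge from \<open>B \<inter> C\<close> to a vertex of \<open>D - B\<close> counts
  for \<open>(C, D)\<close> but for neither of the two uncrossed separations.
\<close>

lemma order_submodular:
  assumes "separation V A B" "separation V C D" "S \<subseteq> D - B"
  shows "sep_order V m (A \<inter> C) (B \<union> D) + sep_order V m (A \<union> C) (B \<inter> D) + cross m (B \<inter> C) S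
       \<le> sep_order V m A B + sep_order V m C D"
proof -
  have sub: "A \<subseteq> V" "B \<subseteq> V" "C \<subseteq> V" "D \<subseteq> V" "S \<subseteq> V"
    using assms by (auto simp: separation_def)
  have c: "card (V - (A \<union> B)) + card (V - (C \<union> D)) =
    card (V - (A \<inter> C \<union> (B \<union> D))) + card (V - (A \<union> C \<union> B \<inter> D))"
    unfolding card_indicator sum.distrib[symmetric]
    using assms by (intro sum.cong) (auto simp: separation_def of_bool_def)
  have i: "cross m A B = (\<Sum>p\<in>V. \<Sum>q\<in>V. m p q * of_bool (p \<in> A \<and> q \<in> B))"
    "cross m C D = (\<Sum>p\<in>V. \<Sum>q\<in>V. m p q * of_bool (p \<in> C \<and> q \<in> D))"
    "cross m (A \<inter> C) (B \<union> D) = (\<Sum>p\<in>V. \<Sum>q\<in>V. m p q * of_bool (p \<in> A \<inter> C \<and> q \<in> B \<union> D))"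
    "cross m (A \<union> C) (B \<inter> D) = (\<Sum>p\<in>V. \<Sum>q\<in>V. m p q * of_bool (p \<in> A \<union> C \<and> q \<in> B \<inter> D))"
    "cross m (B \<inter> C) S = (\<Sum>p\<in>V. \<Sum>q\<in>V. m p q * of_bool (p \<in> B \<inter> C \<and> q \<in> S))"
    using sub by (intro cross_indicator; blast)+
  have "cross m (A \<inter> C) (B \<union> D) + cross m (A \<union> C) (B \<inter> D) + cross m (B \<inter> C) S
      \<le> cross m A B + cross m C D"
    unfolding i sum.distrib[symmetric] distrib_left[symmetric]
    using assms by (intro sum_mono mult_left_mono) (auto simp: separation_def of_bool_def)
  then show ?thesis using c by (simp add: sep_order_def)
qed

text \<open>
  Separating vertices with at most one edge to one of the sides can be moved to the other side
  one after another, so that eventually every remaining separating vertex has at least two edges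
  to both sides. The last conclusion controls which vertices may enter the first side; it keeps
  that side from growing too far in the uncrossing argument.
\<close>

lemma saturate:
  assumes "separation V A B" "sep_order V m A B \<le> k"
  shows "\<exists>A' B'. separation V A' B' \<and> A \<subseteq> A' \<and> B \<subseteq> B' \<and> sep_order V m A' B' \<le> k \<and>
    (\<forall>t\<in>V - (A' \<union> B'). 2 \<le> cross m {t} A' \<and> 2 \<le> cross m {t} B') \<and>
    (\<forall>t\<in>A' - A. cross m {t} B \<le> 1)"
  using assms
proof (induction "card (V - (A \<union> B))" arbitrary: A B rule: less_induct)
  case less
  show ?case
  proof (cases "\<forall>t\<in>V - (A \<union> B). 2 \<le> cross m {t} A \<and> 2 \<le> cross m {t} B")
    case True
    then show ?thesis using less.prems by blast
  next
    case False
    then obtain t where t: "t \<in> V - (A \<union> B)" "cross m {t} A \<le> 1 \<or> cross m {t} B \<le> 1"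
      by fastforce
    show ?thesis
    proof (cases "cross m {t} A \<le> 1")
      case True
      have s: "separation V A (insert t B)" using less.prems t by (auto simp: separation_def)
      have "sep_order V m A (insert t B) \<le> k"
        using order_insert[OF less.prems(1) t(1)] True less.prems by linarith
      moreover have "card (V - (A \<union> insert t B)) < card (V - (A \<union> B))"
        using t finite_V by (intro psubset_card_mono) auto
      ultimately obtain A' B' where 1: "separation V A' B'" "A \<subseteq> A'" "insert t B \<subseteq> B'" "sep_order V m A' B' \<le> k"
        "\<forall>t\<in>V - (A' \<union> B'). 2 \<le> cross m {t} A' \<and> 2 \<le> cross m {t} B'"
        "\<forall>t'\<in>A' - A. cross m {t'} (insert t B) \<le> 1"
        using less.hyps[OF _ s] by blast
      have "cross m {t'} B \<le> cross m {t'} (insert t B)" if "t' \<in> A'" for t'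
        using that s 1(1) by (intro cross_mono) (auto simp: separation_def)
      then have "\<forall>t'\<in>A' - A. cross m {t'} B \<le> 1" using 1(6) order_trans by blast
      then show ?thesis using 1 by blast
    next
      case False
      then have c: "cross m {t} B \<le> 1" using t by simp
      have s: "separation V (insert t A) B" using less.prems t by (auto simp: separation_def)
      have "sep_order V m (insert t A) B + 1 = sep_order V m A B + cross m {t} B"
        using order_insert[of B A t] less.prems(1) t(1) by (simp add: order_commute separation_commute Un_commute)
      then have "sep_order V m (insert t A) B \<le> k"
        using c less.prems by linarith
      moreover have "card (V - (insert t A \<union> B)) < card (V - (A \<union> B))"
        using t finite_V by (intro psubset_card_mono) auto
      ultimately obtain A' B' where 1: "separation V A' B'" "insert t A \<subseteq> A'" "B \<subseteq> B'" "sep_order V m A' B' \<le> k"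
        "\<forall>t\<in>V - (A' \<union> B'). 2 \<le> cross m {t} A' \<and> 2 \<le> cross m {t} B'"
        "\<forall>t'\<in>A' - insert t A. cross m {t'} B \<le> 1"
        using less.hyps[OF _ s] by blast
      then have "\<forall>t'\<in>A' - A. cross m {t'} B \<le> 1" using c by blast
      then show ?thesis using 1 by blast
    qed
  qed
qed

end

section \<open>Uncrossing a smallest separation\<close>

text \<open>
  The last assumption is the form in which \<open>k\<close>-connectedness is used: no separation has order
  below \<open>k\<close>.
\<close>

locale k_connected_multiplicities = multiplicities +
  fixes k :: nat
  assumes k_le: "k \<le> 3"
    and simple: "a \<in> V \<Longrightarrow> b \<in> V \<Longrightarrow> a \<noteq> b \<Longrightarrow> m a b \<le> 1"
    and order_ge: "separation V A B \<Longrightarrow> A \<noteq> {} \<Longrightarrow> B \<noteq> {} \<Longrightarrow> k \<le> sep_order V m A B"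
begin

lemma cross_vertex_le_card:
  assumes "t \<in> V" "B \<subseteq> V" "t \<notin> B"
  shows "cross m {t} B \<le> card B"
proof -
  have "m t b \<le> 1" if "b \<in> B" for b using that assms by (intro simple) auto
  then have "(\<Sum>b\<in>B. m t b) \<le> (\<Sum>b\<in>B. 1)" by (rule sum_mono)
  then show ?thesis by (simp add: cross_def)
qed

text \<open>
  Suppose that every two vertices have a separation of order at most \<open>k\<close>. Call a vertex big if
  its degree exceeds \<open>k\<close>, and consider the separations \<open>(A, B)\<close> of order at most \<open>k\<close> that have a
  big vertex on each side and in which every separating vertex has two edges to both sides;
  choose one with \<open>A\<close> smallest. It has a separating vertex \<open>s\<close>, because small edge cuts are
  trivial and cannot split off a big vertex. Take a big vertex \<open>a \<in> A\<close> and uncross \<open>(A, B)\<close> with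
  a separation \<open>(C, D)\<close> of order at most \<open>k\<close> between \<open>a\<close> and \<open>s\<close>. The corner \<open>A \<inter> C\<close> again
  yields a separation of order at most \<open>k\<close>, and saturating it does not leave \<open>A\<close>. By minimality
  it has the first side \<open>A\<close> itself, but then the edges from \<open>s\<close> to \<open>A\<close> all count towards its
  order, which pushes the order above \<open>k\<close>.

  The bound \<open>k \<le> 3\<close> is needed when the opposite corner \<open>B \<inter> D\<close> is empty. Then the lower bound
  \<open>k\<close> for the order at that corner is missing; \<open>s\<close>, its two edges to \<open>B\<close> and simplicity still
  provide \<open>3\<close>.
\<close>

lemma exists_locally_connected_if_small_cuts_trivial:
  assumes trivial: "\<And>X. X \<subseteq> V \<Longrightarrow> cross m X (V - X) \<le> k \<Longrightarrow> card X \<le> 1 \<or> card (V - X) \<le> 1"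
    and x: "x \<in> V" "k < cross m {x} (V - {x})"
    and y: "y \<in> V" "k < cross m {y} (V - {y})"
    and "x \<noteq> y"
  shows "\<exists>u\<in>V. \<exists>v\<in>V. u \<noteq> v \<and> locally_connected (k + 1) V m u v"
proof (rule ccontr)
  assume "\<not> ?thesis"
  then have ex_sep: "\<exists>A B. separation V A B \<and> u \<in> A \<and> v \<in> B \<and> sep_order V m A B \<le> k"
    if "u \<in> V" "v \<in> V" "u \<noteq> v" for u v
    using that unfolding locally_connected_def by (metis Suc_eq_plus1 not_less_eq_eq)
  define big where "big v \<longleftrightarrow> v \<in> V \<and> k < cross m {v} (V - {v})" for v
  define good where "good = (\<lambda>(A, B). separation V A B \<and> sep_order V m A B \<le> k \<and>
      (\<exists>v\<in>A. big v) \<and> (\<exists>v\<in>B. big v) \<and>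
      (\<forall>t\<in>V - (A \<union> B). 2 \<le> cross m {t} A \<and> 2 \<le> cross m {t} B))"
  obtain A0 B0 where "separation V A0 B0" "x \<in> A0" "y \<in> B0" "sep_order V m A0 B0 \<le> k"
    using ex_sep x y \<open>x \<noteq> y\<close> by blast
  moreover have "big x" "big y" using x y by (auto simp: big_def)
  ultimately have "\<exists>p. good p"
    using saturate[of A0 B0 k] unfolding good_def by blast
  then obtain p where "good p" and least: "\<And>q. good q \<Longrightarrow> card (fst p) \<le> card (fst q)"
    using ex_has_least_nat[of good _ "\<lambda>p. card (fst p)"] by blast
  moreover obtain A B where p: "p = (A, B)" by fastforce
  ultimately have sep: "separation V A B" and ord: "sep_order V m A B \<le> k"
    and "\<exists>v\<in>A. big v" "\<exists>v\<in>B. big v"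
    and sat: "\<And>t. t \<in> V - (A \<union> B) \<Longrightarrow> 2 \<le> cross m {t} A \<and> 2 \<le> cross m {t} B"
    and least: "\<And>A' B'. good (A', B') \<Longrightarrow> card A \<le> card A'"
    unfolding good_def by fastforce+
  then obtain a b where a: "a \<in> A" "big a" and b: "b \<in> B" "big b" by blast
  have sub: "A \<subseteq> V" "B \<subseteq> V" "A \<inter> B = {}" using sep by (auto simp: separation_def)
  \<comment> \<open>Otherwise the separation is a small edge cut, hence trivial, with a single big vertex as one side.\<close>
  have "V - (A \<union> B) \<noteq> {}"
  proof
    assume "V - (A \<union> B) = {}"
    then have AB: "V - A = B" "V - B = A" using sub by auto
    then have "cross m A (V - A) \<le> k" using ord by (simp add: sep_order_def)
    then consider "card A \<le> 1" | "card B \<le> 1" using trivial[OF sub(1)] AB by auto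
    then show False
    proof cases
      case 1
      then have "A = {a}" using a finite_sub[OF sub(1)] card_le_Suc0_iff_eq by fastforce
      then show ?thesis using a \<open>cross m A (V - A) \<le> k\<close> by (simp add: big_def)
    next
      case 2
      then have "B = {b}" using b finite_sub[OF sub(2)] card_le_Suc0_iff_eq by fastforce
      then show ?thesis using b \<open>cross m A (V - A) \<le> k\<close> AB cross_commute[of A B] by (simp add: big_def)
    qed
  qed
  then obtain s where s: "s \<in> V - (A \<union> B)" by blast
  then obtain C D where CD: "separation V C D" "a \<in> C" "s \<in> D" "sep_order V m C D \<le> k"
    using ex_sep[of a s] a by (auto simp: big_def)
  have subCD: "C \<subseteq> V" "D \<subseteq> V" "C \<inter> D = {}" using CD by (auto simp: separation_def)
  have "sep_order V m (A \<inter> C) (B \<union> D) \<le> k"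
  proof (cases "B \<inter> D = {}")
    case False
    have "separation V (A \<union> C) (B \<inter> D)" using sub subCD by (auto simp: separation_def)
    then have "k \<le> sep_order V m (A \<union> C) (B \<inter> D)" using order_ge False a by blast
    then show ?thesis using order_submodular[OF sep CD(1) empty_subsetI] ord CD(4) by linarith
  next
    case True
    \<comment> \<open>Each vertex of \<open>B - C\<close> adds \<open>1\<close> to the order at the empty corner and absorbs at most one
        edge of \<open>s\<close>; the other edges from \<open>s\<close> to \<open>B\<close> end in \<open>B \<inter> C\<close> and are slack.\<close>
    have "insert s (B - C) \<subseteq> V - (A \<union> C \<union> B \<inter> D)" using s sub subCD CD True by auto
    then have "card (insert s (B - C)) \<le> sep_order V m (A \<union> C) (B \<inter> D)"
      unfolding sep_order_def using finite_V by (meson card_mono finite_Diff trans_le_add1)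
    then have 1: "card (B - C) + 1 \<le> sep_order V m (A \<union> C) (B \<inter> D)"
      using s finite_sub[OF sub(2)] by simp
    have "2 \<le> cross m {s} ((B \<inter> C) \<union> (B - C))" using sat[OF s] by (simp add: Int_Diff_Un)
    also have "\<dots> = cross m {s} (B \<inter> C) + cross m {s} (B - C)"
      using sub by (intro cross_Un) auto
    also have "cross m {s} (B - C) \<le> card (B - C)"
      using s sub by (intro cross_vertex_le_card) auto
    finally have "2 \<le> cross m (B \<inter> C) {s} + card (B - C)"
      by (simp add: cross_commute)
    moreover have "{s} \<subseteq> D - B" using s CD by auto
    ultimately show ?thesis
      using order_submodular[OF sep CD(1), of "{s}"] ord CD(4) 1 k_le by linarith
  qed
  moreover have "separation V (A \<inter> C) (B \<union> D)" using sub subCD by (auto simp: separation_def)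
  ultimately obtain A' B' where 1: "separation V A' B'" "A \<inter> C \<subseteq> A'" "B \<union> D \<subseteq> B'"
      "sep_order V m A' B' \<le> k"
      "\<forall>t\<in>V - (A' \<union> B'). 2 \<le> cross m {t} A' \<and> 2 \<le> cross m {t} B'"
      "\<forall>t\<in>A' - (A \<inter> C). cross m {t} (B \<union> D) \<le> 1"
    using saturate by meson
  \<comment> \<open>A vertex of \<open>A'\<close> outside \<open>A\<close> would be a separating vertex of \<open>(A, B)\<close>, with two edges
      to \<open>B\<close>, and such vertices do not enter the first side.\<close>
  have "A' \<subseteq> A"
  proof
    fix t assume t: "t \<in> A'"
    show "t \<in> A"
    proof (rule ccontr)
      assume nA: "t \<notin> A"
      have "t \<in> V - (A \<union> B)" using t nA 1(1,3) by (auto simp: separation_def)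
      then have "2 \<le> cross m {t} B" using sat by blast
      also have "\<dots> \<le> cross m {t} (B \<union> D)"
        using \<open>t \<in> V - _\<close> sub subCD by (intro cross_mono) auto
      also have "\<dots> \<le> 1" using 1(6) t nA by blast
      finally show False by simp
    qed
  qed
  moreover have "good (A', B')" unfolding good_def using 1 a b CD by blast
  ultimately have "A' = A"
    using least finite_sub[OF sub(1)] by (meson card_seteq)
  \<comment> \<open>Now \<open>(A, B')\<close> arises from \<open>(A, B)\<close> by trading the nonempty set \<open>S\<close> of separating vertices for
      at least two edges each.\<close>
  define S where "S = B' - B"
  have B': "B' = B \<union> S" "B \<inter> S = {}" and S: "S \<subseteq> V - (A \<union> B)" "s \<in> S"
    using 1(1,3) CD(3) s \<open>A' = A\<close> by (auto simp: S_def separation_def)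
  have finS: "finite S" using S finite_V finite_subset by blast
  have "cross m A B' = cross m A B + cross m A S"
    using B' S sub by (auto intro!: cross_Un)
  moreover have "2 * card S \<le> cross m A S"
  proof -
    have "(\<Sum>t\<in>S. 2) \<le> (\<Sum>t\<in>S. cross m {t} A)" using sat S by (intro sum_mono) blast
    then show ?thesis by (simp add: cross_singletons[of A S])
  qed
  moreover have "card (V - (A \<union> B)) = card (V - (A \<union> B')) + card S"
  proof -
    have "V - (A \<union> B) = (V - (A \<union> B')) \<union> S" "(V - (A \<union> B')) \<inter> S = {}" using B' S by auto
    then show ?thesis using finite_V finS by (metis card_Un_disjoint finite_Diff)
  qed
  moreover have "card S > 0" using S finS card_gt_0_iff by blast
  moreover have "k \<le> sep_order V m A B" using order_ge[OF sep] a b by blast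
  ultimately show False using 1(4)[unfolded \<open>A' = A\<close>] unfolding sep_order_def by linarith
qed

end

section \<open>Contracting one side of a small edge cut\<close>

text \<open>
  The contracted set \<open>W\<close> is represented by one of its own vertices \<open>w\<close>, so that the vertex type
  stays the same and contraction can be iterated in an induction.
\<close>

definition contract_vertices :: "'v set \<Rightarrow> 'v \<Rightarrow> 'v set \<Rightarrow> 'v set" where
  "contract_vertices W w V = insert w (V - W)"

definition contract_mult :: "'v set \<Rightarrow> 'v \<Rightarrow> ('v \<Rightarrow> 'v \<Rightarrow> nat) \<Rightarrow> 'v \<Rightarrow> 'v \<Rightarrow> nat" where
  "contract_mult W w m a b = cross m (if a = w then W else {a}) (if b = w then W else {b})"

definition expand :: "'v set \<Rightarrow> 'v \<Rightarrow> 'v set \<Rightarrow> 'v set" where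
  "expand W w A = (\<Union>a\<in>A. if a = w then W else {a})"

lemma expand_in: "w \<in> A \<Longrightarrow> expand W w A = A - {w} \<union> W"
  by (auto simp: expand_def)

lemma expand_notin: "w \<notin> A \<Longrightarrow> expand W w A = A"
  by (auto simp: expand_def)

lemma cross_contract:
  assumes "finite V" "W \<subseteq> V" "A \<subseteq> contract_vertices W w V" "B \<subseteq> contract_vertices W w V"
  shows "cross (contract_mult W w m) A B = cross m (expand W w A) (expand W w B)"
proof -
  let ?c = "\<lambda>a. if a = w then W else {a}"
  have fin: "finite W" "finite A" "finite B"
    using assms by (auto simp: contract_vertices_def intro: finite_subset)
  have U: "sum f (expand W w S) = (\<Sum>a\<in>S. sum f (?c a))"
    if "S \<subseteq> contract_vertices W w V" "finite S" for S and f :: "'a \<Rightarrow> nat"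
    unfolding expand_def using that fin
    by (intro sum.UNION_disjoint) (auto simp: contract_vertices_def)
  have "cross (contract_mult W w m) A B = (\<Sum>a\<in>A. \<Sum>b\<in>B. \<Sum>a'\<in>?c a. sum (m a') (?c b))"
    by (simp add: cross_def contract_mult_def)
  also have "\<dots> = (\<Sum>a\<in>A. \<Sum>a'\<in>?c a. \<Sum>b\<in>B. sum (m a') (?c b))"
    by (intro sum.cong[OF refl] sum.swap)
  also have "\<dots> = cross m (expand W w A) (expand W w B)"
    using assms fin by (simp only: cross_def U)
  finally show ?thesis .
qed

context k_connected_multiplicities
begin

text \<open>
  If at most \<open>k\<close> edges leave \<open>W\<close>, contracting \<open>W\<close> to \<open>w\<close> preserves all standing assumptions.
  Parallel edges do not arise: two edges from \<open>W\<close> to the same vertex \<open>b\<close> could be replaced by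
  \<open>b\<close>, giving a separation of order below \<open>k\<close>. Separations with \<open>w\<close> on a side expand to
  separations of the same order. If \<open>w\<close> is a separating vertex, \<open>W\<close> can be put on the side to
  which it sends more edges: as at most three edges leave \<open>W\<close>, at most one then crosses, and it
  costs no more than \<open>w\<close> did.
\<close>

lemma contraction:
  assumes W: "W \<subseteq> V" "w \<in> W" "cross m W (V - W) \<le> k" "2 \<le> card (V - W)"
  shows "k_connected_multiplicities (contract_vertices W w V) (contract_mult W w m) k"
proof
  let ?V = "contract_vertices W w V" and ?m = "contract_mult W w m"
  show "finite ?V" using finite_V by (simp add: contract_vertices_def)
  show "?m a b = ?m b a" for a b by (simp add: contract_mult_def cross_commute)
  show "k \<le> 3" by (rule k_le)
  have new: "cross m W {b} \<le> 1" if b: "b \<in> V - W" for b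
  proof (rule ccontr)
    assume "\<not> ?thesis"
    moreover have "cross m W (V - W) = cross m W (V - W - {b}) + cross m W {b}"
      using b by (subst cross_Un[symmetric]) (auto intro: arg_cong[where f = "cross m W"])
    moreover have "sep_order V m W (V - W - {b}) = 1 + cross m W (V - W - {b})"
    proof -
      have "V - (W \<union> (V - W - {b})) = {b}" using b by auto
      then show ?thesis by (simp add: sep_order_def)
    qed
    moreover have "V - W - {b} \<noteq> {}"
    proof
      assume "V - W - {b} = {}"
      then have "V - W \<subseteq> {b}" by auto
      then have "card (V - W) \<le> card {b}" by (intro card_mono) auto
      then show False using W by simp
    qed
    then have "k \<le> sep_order V m W (V - W - {b})"
      using W b by (intro order_ge) (auto simp: separation_def)
    ultimately show False using W(3) by linarith
  qed
  show "?m a b \<le> 1" if ab: "a \<in> ?V" "b \<in> ?V" "a \<noteq> b" for a b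
  proof -
    consider "a = w" "b \<in> V - W" | "b = w" "a \<in> V - W" | "a \<in> V - W" "b \<in> V - W"
      using ab by (auto simp: contract_vertices_def)
    then show ?thesis
    proof cases
      case 1
      then show ?thesis using new[of b] ab by (simp add: contract_mult_def)
    next
      case 2
      then show ?thesis using new[of a] ab by (simp add: contract_mult_def cross_commute[of "{a}"])
    next
      case 3
      then have "a \<noteq> w" "b \<noteq> w" using W by auto
      then show ?thesis using simple[of a b] 3 ab by (simp add: contract_mult_def cross_def)
    qed
  qed
  show "k \<le> sep_order ?V ?m A B" if sep: "separation ?V A B" and ne: "A \<noteq> {}" "B \<noteq> {}" for A B
  proof -
    have sub: "A \<subseteq> ?V" "B \<subseteq> ?V" "A \<inter> B = {}" using sep by (auto simp: separation_def)
    have c: "cross ?m A B = cross m (expand W w A) (expand W w B)"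
      using sub W finite_V by (intro cross_contract) auto
    have sepE: "separation V (expand W w A) (expand W w B)"
      using sub W by (auto simp: separation_def expand_def contract_vertices_def split: if_splits)
    have neE: "expand W w A \<noteq> {}" "expand W w B \<noteq> {}" using ne W by (auto simp: expand_def)
    show ?thesis
    proof (cases "w \<in> A \<union> B")
      case True
      have "?V - (A \<union> B) = V - (expand W w A \<union> expand W w B)"
        using sub W True by (auto simp: expand_def contract_vertices_def split: if_splits)
      then show ?thesis using order_ge[OF sepE neE] by (simp add: sep_order_def c)
    next
      case False
      then have AB: "A \<subseteq> V - W" "B \<subseteq> V - W" using sub by (auto simp: contract_vertices_def)
      have E: "expand W w A = A" "expand W w B = B" using False by (auto simp: expand_notin)
      have "?V - (A \<union> B) = insert w (V - (A \<union> W \<union> B))" "w \<notin> V - (A \<union> W \<union> B)"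
        using AB W by (auto simp: contract_vertices_def)
      then have o: "sep_order ?V ?m A B = card (V - (A \<union> W \<union> B)) + 1 + cross m A B"
        using finite_V by (simp add: sep_order_def c E)
      have "k \<le> sep_order V m (A \<union> W) B" "k \<le> sep_order V m A (B \<union> W)"
        using AB W ne sub by (auto intro!: order_ge simp: separation_def)
      moreover have "cross m (A \<union> W) B = cross m A B + cross m W B"
        using AB W by (simp add: cross_commute[of _ B] cross_Un Int_commute) (subst cross_Un, auto)
      moreover have "cross m A (B \<union> W) = cross m A B + cross m W A"
        using AB W by (subst cross_Un) (auto simp: cross_commute)
      moreover have "card (V - (A \<union> (B \<union> W))) = card (V - (A \<union> W \<union> B))" by (simp add: Un_ac)
      moreover have "cross m W A + cross m W B \<le> cross m W (V - W)"
        using AB W sub by (subst cross_Un[symmetric]) (auto intro!: cross_mono)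
      ultimately show ?thesis using o W(3) k_le unfolding sep_order_def by linarith
    qed
  qed
qed

text \<open>
  A set \<open>W\<close> behind a small edge cut can be moved entirely to a side that it meets, by
  uncrossing.
\<close>

lemma absorb:
  assumes W: "W \<subseteq> V" "cross m W (V - W) \<le> k"
    and AB: "separation V A B" "sep_order V m A B \<le> k" "A \<inter> W \<noteq> {}" "B - W \<noteq> {}"
  shows "sep_order V m (A \<union> W) (B - W) \<le> k"
proof -
  have sub: "A \<subseteq> V" "B \<subseteq> V" "A \<inter> B = {}" using AB by (auto simp: separation_def)
  have sW: "separation V W (V - W)" using W by (auto simp: separation_def)
  have "k \<le> sep_order V m (A \<inter> W) (B \<union> (V - W))"
    using sub W AB by (intro order_ge) (auto simp: separation_def)
  moreover have "B \<inter> (V - W) = B - W" using sub by auto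
  moreover have "sep_order V m W (V - W) \<le> k" using W by (simp add: sep_order_def Un_absorb1)
  ultimately show ?thesis
    using order_submodular[OF AB(1) sW empty_subsetI] AB(2) by simp
qed

text \<open>
  High local connectivity lifts back from the contraction: by uncrossing a small separation of
  the original graph may be assumed to have all of \<open>W\<close> on one side, or else \<open>W\<close> lies among the
  separating vertices; in both cases it induces a small separation of the contraction. Neither
  \<open>u\<close> nor \<open>v\<close> is the contracted vertex, whose degree is at most \<open>k\<close>.
\<close>

lemma locally_connected_contraction:
  assumes W: "W \<subseteq> V" "w \<in> W" "cross m W (V - W) \<le> k"
    and uv: "u \<in> contract_vertices W w V" "v \<in> contract_vertices W w V" "u \<noteq> v"
    and lc: "locally_connected (k + 1) (contract_vertices W w V) (contract_mult W w m) u v"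
  shows "u \<in> V - W \<and> v \<in> V - W \<and> locally_connected (k + 1) V m u v"
proof -
  let ?V = "contract_vertices W w V" and ?m = "contract_mult W w m"
  have lc: "k + 1 \<le> sep_order ?V ?m A B" if "separation ?V A B" "u \<in> A" "v \<in> B" for A B
    using lc that by (simp add: locally_connected_def)
  have c: "cross ?m A B = cross m (expand W w A) (expand W w B)" if "separation ?V A B" for A B
    using that W finite_V by (intro cross_contract) (auto simp: separation_def)
  have V: "?V = insert w (V - W)" by (simp add: contract_vertices_def)
  have cW: "?V - {w} = V - W" using W by (auto simp: V)
  have "u \<noteq> w"
  proof
    assume "u = w"
    have s: "separation ?V {w} (V - W)" using W by (auto simp: V separation_def)
    have e: "?V - ({w} \<union> (V - W)) = {}" by (auto simp: V)
    have "sep_order ?V ?m {w} (V - W) \<le> k"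
      using W unfolding sep_order_def e c[OF s] by (simp add: expand_in expand_notin)
    then show False using lc[OF s] \<open>u = w\<close> uv cW by auto
  qed
  moreover have "v \<noteq> w"
  proof
    assume "v = w"
    have s: "separation ?V (V - W) {w}" using W by (auto simp: V separation_def)
    have e: "?V - ((V - W) \<union> {w}) = {}" by (auto simp: V)
    have "sep_order ?V ?m (V - W) {w} \<le> k"
      using W unfolding sep_order_def e c[OF s] by (simp add: expand_in expand_notin cross_commute[of "V - W"])
    then show False using lc[OF s] \<open>v = w\<close> uv cW by auto
  qed
  ultimately have uvW: "u \<in> V - W" "v \<in> V - W" using uv by (auto simp: V)
  have "k + 1 \<le> sep_order V m A B" if sep: "separation V A B" and uA: "u \<in> A" and vB: "v \<in> B" for A B
  proof (rule ccontr)
    assume "\<not> ?thesis"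
    then have small: "sep_order V m A B \<le> k" by simp
    have sub: "A \<subseteq> V" "B \<subseteq> V" "A \<inter> B = {}" using sep by (auto simp: separation_def)
    consider "A \<inter> W \<noteq> {}" | "B \<inter> W \<noteq> {}" | "(A \<union> B) \<inter> W = {}" by blast
    then show False
    proof cases
      case 1
      then have o: "sep_order V m (A \<union> W) (B - W) \<le> k"
        using vB uvW by (intro absorb[OF W(1,3) sep small]) auto
      have s: "separation ?V (insert w (A - W)) (B - W)" using sub W by (auto simp: V separation_def)
      have e: "expand W w (insert w (A - W)) = A \<union> W" "expand W w (B - W) = B - W"
        using W by (auto simp: expand_in expand_notin)
      have "?V - (insert w (A - W) \<union> (B - W)) = V - (A \<union> W \<union> (B - W))" using W by (auto simp: V)
      then have "sep_order ?V ?m (insert w (A - W)) (B - W) \<le> k"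
        using o by (simp add: sep_order_def c[OF s] e)
      then show False using lc[OF s] uA vB uvW by auto
    next
      case 2
      then have o: "sep_order V m (B \<union> W) (A - W) \<le> k"
        using uA uvW sep small
        by (intro absorb[OF W(1,3)]) (auto simp: separation_commute order_commute[of B])
      have s: "separation ?V (A - W) (insert w (B - W))" using sub W by (auto simp: V separation_def)
      have e: "expand W w (insert w (B - W)) = B \<union> W" "expand W w (A - W) = A - W"
        using W by (auto simp: expand_in expand_notin)
      have "?V - ((A - W) \<union> insert w (B - W)) = V - (B \<union> W \<union> (A - W))" using W by (auto simp: V)
      then have "sep_order ?V ?m (A - W) (insert w (B - W)) \<le> k"
        using o by (simp add: sep_order_def c[OF s] e cross_commute[of "A - W"])
      then show False using lc[OF s] uA vB uvW by auto
    next
      case 3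
      then have s: "separation ?V A B" using sub by (auto simp: V separation_def)
      have e: "expand W w A = A" "expand W w B = B" using 3 W by (auto intro!: expand_notin)
      have "card (?V - (A \<union> B)) \<le> card (V - (A \<union> B))"
        using W finite_V by (intro card_mono) (auto simp: V)
      then have "sep_order ?V ?m A B \<le> k" using small by (simp add: sep_order_def c[OF s] e)
      then show False using lc[OF s] uA vB by auto
    qed
  qed
  then show ?thesis using uvW by (simp add: locally_connected_def)
qed

end

text \<open>
  The hypothesis on the sets \<open>X\<close> is what \<open>k + 1\<close> edge-disjoint paths between \<open>x\<close> and \<open>y\<close>
  provide. As long as some edge cut of size at most \<open>k\<close> has two vertices on each side, \<open>x\<close> and
  \<open>y\<close> lie on the same side of it and the other side is contracted; every edge cut of the
  contraction is one of the original graph. Once there is no such cut, the uncrossing argument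
  applies.
\<close>

theorem exists_locally_connected:
  assumes "k_connected_multiplicities V m k"
    and "x \<in> V" "y \<in> V" and "x \<noteq> y"
    and "\<And>X. X \<subseteq> V \<Longrightarrow> x \<in> X \<Longrightarrow> y \<notin> X \<Longrightarrow> k < cross m X (V - X)"
  shows "\<exists>u\<in>V. \<exists>v\<in>V. u \<noteq> v \<and> locally_connected (k + 1) V m u v"
  using assms(1-3,5)
proof (induction "card V" arbitrary: V m rule: less_induct)
  case less
  interpret k_connected_multiplicities V m k by (rule less.prems)
  note cut = less.prems(4)
  have V: "x \<in> V" "y \<in> V" by (rule less.prems)+
  have cut': "k < cross m X (V - X)" if "X \<subseteq> V" "x \<notin> X" "y \<in> X" for X
  proof -
    have "V - (V - X) = X" using that by auto
    then show ?thesis using cut[of "V - X"] that V cross_commute[of X] by simp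
  qed
  show ?case
  proof (cases "\<forall>X\<subseteq>V. cross m X (V - X) \<le> k \<longrightarrow> card X \<le> 1 \<or> card (V - X) \<le> 1")
    case True
    then show ?thesis
      using V \<open>x \<noteq> y\<close> cut[of "{x}"] cut'[of "{y}"]
      by (intro exists_locally_connected_if_small_cuts_trivial[of x y]) auto
  next
    case False
    then obtain X where "X \<subseteq> V" "cross m X (V - X) \<le> k" "\<not> card X \<le> 1" "\<not> card (V - X) \<le> 1"
      by blast
    then have X: "X \<subseteq> V" "cross m X (V - X) \<le> k" "2 \<le> card X" "2 \<le> card (V - X)"
      by simp_all
    then have same: "x \<in> X \<longleftrightarrow> y \<in> X" using cut cut' by (meson not_le)
    define W where "W = (if x \<in> X then V - X else X)"
    have "V - (V - X) = X" using X by auto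
    then have W: "W \<subseteq> V" "cross m W (V - W) \<le> k" "2 \<le> card W" "2 \<le> card (V - W)" "x \<notin> W" "y \<notin> W"
      using X same cross_commute[of X] by (auto simp: W_def)
    then have "W \<noteq> {}" by auto
    then obtain w where w: "w \<in> W" by blast
    let ?V = "contract_vertices W w V" and ?m = "contract_mult W w m"
    have "card ?V = card (V - W) + 1"
      using w finite_V by (simp add: contract_vertices_def)
    also have "\<dots> < card (V - W) + card W" using W by simp
    also have "\<dots> = card V" using W(1) finite_V by (simp add: card_Diff_subset card_mono finite_sub)
    finally have "card ?V < card V" .
    moreover have "k_connected_multiplicities ?V ?m k" using W w by (intro contraction)
    moreover have "x \<in> ?V" "y \<in> ?V" using V W by (auto simp: contract_vertices_def)
    moreover have "k < cross ?m X (?V - X)" if X: "X \<subseteq> ?V" "x \<in> X" "y \<notin> X" for X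
    proof -
      have E: "expand W w (?V - X) = V - expand W w X" "expand W w X \<subseteq> V" "x \<in> expand W w X" "y \<notin> expand W w X"
        using X W w by (auto simp: expand_def contract_vertices_def split: if_splits)
      have "cross ?m X (?V - X) = cross m (expand W w X) (expand W w (?V - X))"
        using X W finite_V by (intro cross_contract) auto
      then show ?thesis using cut[OF E(2-4)] E(1) by simp
    qed
    ultimately obtain u v where "u \<in> ?V" "v \<in> ?V" "u \<noteq> v" "locally_connected (k + 1) ?V ?m u v"
      using less.hyps by blast
    then show ?thesis using locally_connected_contraction[OF W(1) w W(2), of u v] by blast
  qed
qed

section \<open>The theorems of Hall and Menger\<close>

text \<open>
  Hall's marriage theorem. Rado's proof: as long as some \<open>A i\<close> has two elements, one of them can
  be deleted without violating Hall's condition. If neither could, there would be two index sets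
  witnessing this, and counting their union (with \<open>i\<close>) and their intersection contradicts Hall's
  condition.
\<close>

lemma hall:
  fixes A :: "'i \<Rightarrow> 'a set"
  assumes "finite I" "\<And>i. i \<in> I \<Longrightarrow> finite (A i)"
    and "\<And>J. J \<subseteq> I \<Longrightarrow> card J \<le> card (\<Union>i\<in>J. A i)"
  shows "\<exists>f. inj_on f I \<and> (\<forall>i\<in>I. f i \<in> A i)"
  using assms
proof (induction "\<Sum>i\<in>I. card (A i)" arbitrary: A rule: less_induct)
  case less
  note fin = less.prems(2) and hall = less.prems(3)
  show ?case
  proof (cases "\<exists>i\<in>I. \<exists>x\<in>A i. \<exists>y\<in>A i. x \<noteq> y")
    case False
    have "A i \<noteq> {}" if "i \<in> I" for i using hall[of "{i}"] that by auto
    then have "\<forall>i\<in>I. \<exists>a. a \<in> A i" by blast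
    then obtain f where f: "\<And>i. i \<in> I \<Longrightarrow> f i \<in> A i" 
      using bchoice[of I "\<lambda>i a. a \<in> A i"] by blast
    have "inj_on f I"
    proof (rule inj_onI, rule ccontr)
      fix i j assume ij: "i \<in> I" "j \<in> I" "f i = f j" "i \<noteq> j"
      have "A l \<subseteq> {f l}" if "l \<in> I" for l using False f that by blast
      then have "(\<Union>l\<in>{i, j}. A l) \<subseteq> {f i}" using ij by auto
      then have "card (\<Union>l\<in>{i, j}. A l) \<le> card {f i}" by (intro card_mono) auto
      then show False using hall[of "{i, j}"] ij by simp
    qed
    then show ?thesis using f by blast
  next
    case True
    then obtain i x y where i: "i \<in> I" "x \<in> A i" "y \<in> A i" "x \<noteq> y" by blast
    have finU: "finite (\<Union>l\<in>J. A l)" if "J \<subseteq> I" for J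
      using that fin \<open>finite I\<close> by (auto intro: finite_subset)
    show ?thesis
    proof (rule ccontr)
      assume no: "\<not> ?thesis"
      have crit: "\<exists>J\<subseteq>I - {i}. card ((\<Union>l\<in>J. A l) \<union> (A i - {z})) \<le> card J" if z: "z \<in> A i" for z
      proof (rule ccontr)
        assume "\<not> ?thesis"
        then have nc: "card J < card ((\<Union>l\<in>J. A l) \<union> (A i - {z}))" if "J \<subseteq> I - {i}" for J
          using that not_le by metis
        define A' where "A' = A(i := A i - {z})"
        have "(\<Sum>l\<in>I. card (A' l)) < (\<Sum>l\<in>I. card (A l))"
        proof (rule sum_strict_mono_ex1)
          show "finite I" by fact
          show "\<forall>l\<in>I. card (A' l) \<le> card (A l)" by (simp add: A'_def card_Diff1_le)
          show "\<exists>l\<in>I. card (A' l) < card (A l)" 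
            using i(1) z fin card_Diff1_less[of "A i" z] by (intro bexI[of _ i]) (simp_all add: A'_def)
        qed
        moreover have "card J \<le> card (\<Union>l\<in>J. A' l)" if J: "J \<subseteq> I" for J
        proof (cases "i \<in> J")
          case False
          then have "(\<Union>l\<in>J. A' l) = (\<Union>l\<in>J. A l)" by (auto simp: A'_def)
          then show ?thesis using hall J by simp
        next
          case True
          have "(\<Union>l\<in>J. A' l) = (\<Union>l\<in>J - {i}. A l) \<union> (A i - {z})"
            using True by (auto simp: A'_def)
          moreover have "card (J - {i}) < card ((\<Union>l\<in>J - {i}. A l) \<union> (A i - {z}))"
            using J by (intro nc) auto
          ultimately show ?thesis using True by (simp add: card_Diff_singleton)
        qed
        moreover have "finite (A' l)" if "l \<in> I" for l
          using fin that by (auto simp: A'_def)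
        ultimately have "\<exists>f. inj_on f I \<and> (\<forall>l\<in>I. f l \<in> A' l)"
          using less.hyps[OF _ \<open>finite I\<close>] by simp
        moreover have "A' l \<subseteq> A l" for l by (auto simp: A'_def)
        ultimately show False using no by blast
      qed
      obtain J K where J: "J \<subseteq> I - {i}" "card ((\<Union>l\<in>J. A l) \<union> (A i - {x})) \<le> card J"
        and K: "K \<subseteq> I - {i}" "card ((\<Union>l\<in>K. A l) \<union> (A i - {y})) \<le> card K"
        using crit i by meson
      let ?P = "(\<Union>l\<in>J. A l) \<union> (A i - {x})" and ?Q = "(\<Union>l\<in>K. A l) \<union> (A i - {y})"
      have fins: "finite ?P" "finite ?Q" "finite J" "finite K"
        using J K finU[of J] finU[of K] fin[OF i(1)] \<open>finite I\<close> by (auto intro: finite_subset)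
      have "card (insert i (J \<union> K)) \<le> card (\<Union>l\<in>insert i (J \<union> K). A l)"
        using J K i by (intro hall) auto
      also have "(\<Union>l\<in>insert i (J \<union> K). A l) = ?P \<union> ?Q" using i by auto
      finally have "card (J \<union> K) + 1 \<le> card (?P \<union> ?Q)"
        using fins J K by (subst (asm) card_insert_disjoint) auto
      moreover have "card (J \<inter> K) \<le> card (?P \<inter> ?Q)"
      proof -
        have "card (J \<inter> K) \<le> card (\<Union>l\<in>J \<inter> K. A l)" using J by (intro hall) auto
        also have "\<dots> \<le> card (?P \<inter> ?Q)" using fins by (intro card_mono) auto
        finally show ?thesis .
      qed
      ultimately show False
        using J(2) K(2) card_Un_Int[OF fins(1,2)] card_Un_Int[OF fins(3,4)] by linarith
    qed
  qed
qed

text \<open>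
  Menger's theorem for disjoint paths from \<open>X\<close> to \<open>Y\<close>, derived from Hall's theorem. Adjoin \<open>n\<close>
  terminals, each of which may be mapped to any vertex of \<open>X\<close>; let a vertex be mapped to itself
  or along \<open>R\<close>, and a vertex of \<open>Y\<close> also to any terminal. A system of distinct representatives
  is a permutation, and following it from each terminal until it comes back to a terminal traces
  \<open>n\<close> disjoint paths. In Hall's condition, a set of vertices \<open>Z\<close> avoiding \<open>Y\<close> together with some
  terminals has the neighbours \<open>X \<union> Z \<union> R `` Z\<close>, which is where the hypothesis on cuts enters;
  in \<open>X \<union> R `` Z - Z\<close> one recognises the separator that guards \<open>Z\<close>.
\<close>

lemma menger_sets:
  fixes R :: "('a \<times> 'a) set"
  assumes fin: "finite N" and sub: "X \<subseteq> N" "Y \<subseteq> N" "R \<subseteq> N \<times> N"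
    and cut: "\<And>Z. Z \<subseteq> N - Y \<Longrightarrow> n \<le> card (X \<union> R `` Z - Z)"
  shows "\<exists>p. (\<forall>i<n. p i \<noteq> [] \<and> distinct (p i) \<and> set (p i) \<subseteq> N \<and> hd (p i) \<in> X \<and> last (p i) \<in> Y \<and>
                 successively (\<lambda>a b. (a, b) \<in> R) (p i)) \<and>
             (\<forall>i<n. \<forall>j<n. i \<noteq> j \<longrightarrow> set (p i) \<inter> set (p j) = {})"
proof -
  define I :: "(nat + 'a) set" where "I = Inl ` {..<n} \<union> Inr ` N"
  define T :: "nat + 'a \<Rightarrow> (nat + 'a) set" where
    "T = case_sum (\<lambda>_. Inr ` X) (\<lambda>v. Inr ` insert v (R `` {v}) \<union> (if v \<in> Y then Inl ` {..<n} else {}))"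
  have finI: "finite I" using fin by (simp add: I_def)
  have TI: "T i \<subseteq> I" if "i \<in> I" for i
  proof -
    have "Inr ` X \<subseteq> I" "Inl ` {..<n} \<subseteq> I" using sub unfolding I_def by blast+
    moreover have "Inr ` insert v (R `` {v}) \<subseteq> I" if "Inr v \<in> I" for v
      using that sub unfolding I_def by blast
    ultimately show ?thesis using that by (cases i) (simp_all add: T_def)
  qed
  have "card J \<le> card (\<Union>i\<in>J. T i)" if J: "J \<subseteq> I" for J
  proof -
    define D Z where "D = {i. Inl i \<in> J}" and "Z = {v. Inr v \<in> J}"
    have J_eq: "J = Inl ` D \<union> Inr ` Z"
    proof (rule set_eqI)
      fix z show "z \<in> J \<longleftrightarrow> z \<in> Inl ` D \<union> Inr ` Z" by (cases z) (auto simp: D_def Z_def)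
    qed
    have D: "D \<subseteq> {..<n}" and Z: "Z \<subseteq> N" using J by (auto simp: D_def Z_def I_def)
    then have f: "finite D" "finite Z" using fin finite_subset by auto
    have "D = {} \<or> D \<noteq> {} \<and> card D \<le> n" using D card_mono[of "{..<n}" D] by auto
    moreover have cJ: "card J = card D + card Z"
      unfolding J_eq using f by (subst card_Un_disjoint) (auto simp: card_image)
    have finT: "finite (\<Union>i\<in>J. T i)" using J TI finI by (meson UN_least finite_subset subsetD)
    have ZT: "Inr ` Z \<subseteq> (\<Union>i\<in>J. T i)" by (auto simp: J_eq T_def)
    ultimately consider "D = {}" | "D \<noteq> {}" "card D \<le> n" "Z \<inter> Y \<noteq> {}" | "D \<noteq> {}" "card D \<le> n" "Z \<inter> Y = {}"
      by blast
    then show ?thesis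
    proof cases
      case 1
      then show ?thesis using card_mono[OF finT ZT] cJ by (simp add: card_image)
    next
      case 2
      then have "Inl ` {..<n} \<union> Inr ` Z \<subseteq> (\<Union>i\<in>J. T i)" using ZT by (auto simp: J_eq T_def)
      then have "card (Inl ` {..<n} \<union> Inr ` Z :: (nat + 'a) set) \<le> card (\<Union>i\<in>J. T i)" by (rule card_mono[OF finT])
      moreover have "card (Inl ` {..<n} \<union> Inr ` Z :: (nat + 'a) set) = n + card Z"
        using f by (subst card_Un_disjoint) (auto simp: card_image)
      ultimately show ?thesis using cJ 2 by linarith
    next
      case 3
      have "Inr ` (Z \<union> (X \<union> R `` Z - Z)) \<subseteq> (\<Union>i\<in>J. T i)" using 3 by (auto simp: J_eq T_def)
      then have "card (Inr ` (Z \<union> (X \<union> R `` Z - Z)) :: (nat + 'a) set) \<le> card (\<Union>i\<in>J. T i)"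
        by (rule card_mono[OF finT])
      moreover have "finite (X \<union> R `` Z - Z)" using sub fin by (auto intro: finite_subset)
      then have "card (Inr ` (Z \<union> (X \<union> R `` Z - Z)) :: (nat + 'a) set) = card Z + card (X \<union> R `` Z - Z)"
        using f by (subst card_image, simp, subst card_Un_disjoint) auto
      moreover have "n \<le> card (X \<union> R `` Z - Z)" using 3 Z by (intro cut) auto
      ultimately show ?thesis using cJ 3 by linarith
    qed
  qed
  then obtain f0 where f0: "inj_on f0 I" "\<And>i. i \<in> I \<Longrightarrow> f0 i \<in> T i"
    using hall[OF finI, of T] TI finI by (meson finite_subset)
  \<comment> \<open>Extending by the identity makes the injection total, so that all its powers are injective.\<close>
  define f where "f z = (if z \<in> I then f0 z else z)" for z
  have fT: "f z \<in> T z" and fI: "f z \<in> I" if "z \<in> I" for z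
    using f0 TI that by (auto simp: f_def)
  have inj: "inj f"
  proof (rule injI)
    fix a b assume "f a = f b"
    then show "a = b" using f0(1) fI[of a] fI[of b]
      by (cases "a \<in> I"; cases "b \<in> I") (auto simp: f_def dest: inj_onD)
  qed
  have itI: "(f ^^ t) z \<in> I" if "z \<in> I" for t z
    using that fI by (induction t) auto
  have shift: "z = (f ^^ (b - a)) z'" if "(f ^^ a) z = (f ^^ b) z'" "a \<le> b" for a b z z'
  proof -
    have "(f ^^ b) z' = (f ^^ a) ((f ^^ (b - a)) z')"
      using that(2) by (metis comp_apply funpow_add le_add_diff_inverse)
    then show ?thesis using that(1) inj_fn[OF inj, of a] by (metis injD)
  qed
  have return: "\<exists>t>0. (f ^^ t) (Inl i) \<in> range Inl" if "i < n" for i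
  proof -
    have "Inl i \<in> I" using that by (simp add: I_def)
    then have "range (\<lambda>t. (f ^^ t) (Inl i)) \<subseteq> I" using itI by blast
    then have "\<not> inj (\<lambda>t. (f ^^ t) (Inl i))" using finI finite_subset finite_imageD infinite_UNIV_nat by blast
    then obtain a b where "a < b" "(f ^^ a) (Inl i) = (f ^^ b) (Inl i)"
      unfolding inj_def by (metis linorder_neqE_nat)
    then have "Inl i = (f ^^ (b - a)) (Inl i)" using shift by simp
    then show ?thesis using \<open>a < b\<close> by (metis rangeI zero_less_diff)
  qed
  \<comment> \<open>The first return to a terminal; the vertices strictly before it form the path.\<close>
  define r where "r i = (LEAST t. t > 0 \<and> (f ^^ t) (Inl i) \<in> range Inl)" for i
  have r: "r i > 0" "(f ^^ r i) (Inl i) \<in> range Inl" if "i < n" for i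
    using LeastI_ex[OF return[OF that]] unfolding r_def by auto
  have r_least: "(f ^^ t) (Inl i) \<notin> range Inl" if "0 < t" "t < r i" for i t
    using not_less_Least[of t] that unfolding r_def by blast
  define v where "v i t = projr ((f ^^ t) (Inl i))" for i t
  have v: "(f ^^ t) (Inl i) = Inr (v i t)" if "0 < t" "t < r i" for i t
    using r_least[OF that] by (cases "(f ^^ t) (Inl i)") (auto simp: v_def)
  have vN: "v i t \<in> N" if "i < n" "0 < t" "t < r i" for i t
    using itI[of "Inl i" t] that v[of t i] by (auto simp: I_def)
  have v_inj: "i = j \<and> a = b" if v_eq: "v i a = v j b" and "i < n" "j < n" "0 < a" "a \<le> b" "b < r j" "a < r i" for i j a b
  proof -
    have "(f ^^ a) (Inl i) = (f ^^ b) (Inl j)" using v that by simp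
    then have "Inl i = (f ^^ (b - a)) (Inl j)" using shift \<open>a \<le> b\<close> by blast
    moreover have "(f ^^ (b - a)) (Inl j) \<notin> range Inl" if "a < b"
      using that \<open>0 < a\<close> \<open>b < r j\<close> by (intro r_least) auto
    ultimately have "\<not> a < b" by (metis rangeI)
    then have "a = b" using \<open>a \<le> b\<close> by simp
    then show ?thesis using \<open>Inl i = _\<close> by simp
  qed
  have start: "1 < r i" "v i 1 \<in> X" if "i < n" for i
  proof -
    have f1: "f (Inl i) \<in> Inr ` X" using fT[of "Inl i"] that by (auto simp: I_def T_def)
    then have "r i \<noteq> 1" using r[OF that] by auto
    then show "1 < r i" using r[OF that] by simp
    then show "v i 1 \<in> X" using f1 v[of 1 i] by auto
  qed
  have step: "f (Inr (v i t)) = (f ^^ Suc t) (Inl i)" if "0 < t" "t < r i" for i t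
    using v[OF that] by simp
  define p where "p i = map (v i) [1..<r i]" for i
  have "distinct (p i)" if "i < n" for i
  proof -
    have "inj_on (v i) {1..<r i}"
    proof (rule inj_onI)
      fix a b assume "a \<in> {1..<r i}" "b \<in> {1..<r i}" "v i a = v i b"
      then show "a = b" using v_inj[of i a i b] v_inj[of i b i a] that by (cases "a \<le> b") auto
    qed
    then show ?thesis by (simp add: p_def distinct_map)
  qed
  moreover have "p i \<noteq> []" "hd (p i) \<in> X" if "i < n" for i
    using start[OF that] by (auto simp: p_def hd_map)
  moreover have "set (p i) \<subseteq> N" if "i < n" for i
    using vN[OF that] by (auto simp: p_def)
  moreover have "last (p i) \<in> Y" if "i < n" for i
  proof -
    have l: "last (p i) = v i (r i - 1)" using start[OF that] by (auto simp: p_def last_map)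
    have "f (Inr (v i (r i - 1))) = (f ^^ r i) (Inl i)" using step[of "r i - 1" i] start[OF that] by simp
    then have "f (Inr (v i (r i - 1))) \<in> range Inl" using r[OF that] by simp
    moreover have "f (Inr (v i (r i - 1))) \<in> T (Inr (v i (r i - 1)))"
      using vN[of i "r i - 1"] start[OF that] that by (intro fT) (auto simp: I_def)
    ultimately show ?thesis unfolding l by (auto simp: T_def split: if_splits)
  qed
  moreover have "successively (\<lambda>a b. (a, b) \<in> R) (p i)" if "i < n" for i
    unfolding successively_conv_nth
  proof (intro allI impI)
    fix t assume t: "Suc t < length (p i)"
    then have t': "Suc (Suc t) < r i" by (simp add: p_def)
    have "f (Inr (v i (Suc t))) = Inr (v i (Suc (Suc t)))"
      using step[of "Suc t" i] v[of "Suc (Suc t)" i] t' by simp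
    moreover have "f (Inr (v i (Suc t))) \<in> T (Inr (v i (Suc t)))"
      using vN[of i "Suc t"] t' that by (intro fT) (auto simp: I_def)
    moreover have "v i (Suc t) \<noteq> v i (Suc (Suc t))"
      using v_inj[of i "Suc t" i "Suc (Suc t)"] that t' by auto
    ultimately have "(v i (Suc t), v i (Suc (Suc t))) \<in> R" by (auto simp: T_def split: if_splits)
    then show "(p i ! t, p i ! Suc t) \<in> R" using t by (simp add: p_def)
  qed
  moreover have "set (p i) \<inter> set (p j) = {}" if "i < n" "j < n" "i \<noteq> j" for i j
  proof (rule ccontr)
    assume "set (p i) \<inter> set (p j) \<noteq> {}"
    then have "v i ` {1..<r i} \<inter> v j ` {1..<r j} \<noteq> {}" by (simp add: p_def)
    then obtain a b where "a \<in> {1..<r i}" "b \<in> {1..<r j}" "v i a = v j b" by blast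
    then show False using v_inj[of i a j b] v_inj[of j b i a] that by (cases "a \<le> b") auto
  qed
  ultimately show ?thesis by (intro exI[of _ p] conjI allI impI) simp_all
qed

section \<open>Paths and cuts in multigraphs\<close>

definition mult :: "('v, 'e) pre_multigraph \<Rightarrow> 'v \<Rightarrow> 'v \<Rightarrow> nat" where
  "mult G a b = card {e \<in> edges G. ends G e = {a, b}}"

lemma exists_is_path:
  assumes vs: "vs \<noteq> []" "distinct vs" "set vs \<subseteq> verts G"
    and adj: "successively (\<lambda>a b. \<exists>e\<in>edges G. ends G e = {a, b}) vs"
  shows "\<exists>es. is_path G (vs, es)"
proof -
  obtain e where e: "\<And>i. Suc i < length vs \<Longrightarrow> e i \<in> edges G \<and> ends G (e i) = {vs ! i, vs ! Suc i}"
    using adj unfolding successively_conv_nth by metis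
  have "is_path G (vs, map e [0..<length vs - 1])"
    using vs e by (auto simp: is_path_def path_verts_def path_edges_def)
  then show ?thesis ..
qed

lemma path_crosses:
  assumes "is_path_between G a p b" "a \<in> X" "b \<notin> X"
  shows "\<exists>e\<in>path_edges p. \<exists>c\<in>X \<inter> path_verts p. \<exists>d\<in>path_verts p - X. e \<in> edges G \<and> ends G e = {c, d}"
proof -
  obtain vs es where p: "p = (vs, es)" by fastforce
  have path: "length vs = Suc (length es)" "set es \<subseteq> edges G"
    "\<And>i. i < length es \<Longrightarrow> ends G (es ! i) = {vs ! i, vs ! Suc i}" "hd vs = a" "last vs = b"
    using assms(1) by (auto simp: p is_path_between_def is_path_def path_verts_def path_edges_def)
  then have ends: "vs ! 0 \<in> X" "vs ! length es \<notin> X"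
    using assms(2,3) by (metis hd_conv_nth length_0_conv nat.distinct(1), metis diff_Suc_1 last_conv_nth length_0_conv nat.distinct(1))
  have "\<exists>i<length es. vs ! i \<in> X \<and> vs ! Suc i \<notin> X"
    using ends ex_least_nat_less[of "\<lambda>i. vs ! i \<notin> X" "length es"] by auto
  then obtain i where i: "i < length es" "vs ! i \<in> X" "vs ! Suc i \<notin> X" by blast
  then show ?thesis
    using path by (intro bexI[of _ "es ! i"] bexI[of _ "vs ! i"] bexI[of _ "vs ! Suc i"])
      (auto simp: p path_edges_def path_verts_def)
qed

context multigraph
begin

lemma multiplicities_mult: "multiplicities (verts G) (mult G)"
  by unfold_locales (simp_all add: finite_verts mult_def insert_commute)

lemma multiplicities_simple: "multiplicities (verts G) (\<lambda>a b. min 1 (mult G a b))"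
  by unfold_locales (simp_all add: finite_verts mult_def insert_commute)

lemma mult_pos_iff: "0 < mult G a b \<longleftrightarrow> (\<exists>e\<in>edges G. ends G e = {a, b})"
  using finite_edges by (auto simp: mult_def card_gt_0_iff)

lemma card_edges_le_cross:
  "card {e \<in> edges G. \<exists>a\<in>A. \<exists>b\<in>B. ends G e = {a, b}} \<le> cross (mult G) A B"
  if "A \<subseteq> verts G" "B \<subseteq> verts G"
proof -
  have fin: "finite A" "finite B" using that finite_verts finite_subset by blast+
  have "{e \<in> edges G. \<exists>a\<in>A. \<exists>b\<in>B. ends G e = {a, b}} =
    (\<Union>a\<in>A. \<Union>b\<in>B. {e \<in> edges G. ends G e = {a, b}})" by auto
  also have "card \<dots> \<le> (\<Sum>a\<in>A. card (\<Union>b\<in>B. {e \<in> edges G. ends G e = {a, b}}))"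
    using fin(1) by (rule card_UN_le)
  also have "\<dots> \<le> cross (mult G) A B"
    unfolding cross_def mult_def using fin by (intro sum_mono card_UN_le)
  finally show ?thesis .
qed

lemma edge_disjoint_paths_le_cross:
  assumes "connected_by_edge_disjoint_paths G n x y" "X \<subseteq> verts G" "x \<in> X" "y \<notin> X"
  shows "n \<le> cross (mult G) X (verts G - X)"
proof -
  obtain P where P: "finite P" "card P = n" "\<And>p. p \<in> P \<Longrightarrow> is_path_between G x p y" "edge_disjoint P"
    using assms(1) unfolding connected_by_edge_disjoint_paths_def by blast
  let ?C = "{e \<in> edges G. \<exists>a\<in>X. \<exists>b\<in>verts G - X. ends G e = {a, b}}"
  have "\<exists>e. e \<in> path_edges p \<inter> ?C" if "p \<in> P" for p
  proof -
    have "path_verts p \<subseteq> verts G" using P(3)[OF that] by (auto simp: is_path_between_def is_path_def)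
    then show ?thesis using path_crosses[OF P(3)[OF that] assms(3,4)] by blast
  qed
  then obtain f where f: "\<And>p. p \<in> P \<Longrightarrow> f p \<in> path_edges p \<inter> ?C"
    using bchoice[of P "\<lambda>p e. e \<in> path_edges p \<inter> ?C"] by blast
  have "inj_on f P"
  proof (rule inj_onI, rule ccontr)
    fix p q assume "p \<in> P" "q \<in> P" "f p = f q" "p \<noteq> q"
    then show False
      using f[of p] f[of q] P(4) unfolding edge_disjoint_def disjoint_family_on_def by fastforce
  qed
  then have "card P \<le> card ?C" using f finite_edges by (intro card_inj_on_le[of f]) auto
  then show ?thesis using card_edges_le_cross[of X "verts G - X"] assms(2) P(2) by simp
qed

text \<open>
  \<open>k\<close>-connectedness is about deleting vertices, whereas separations also contain edges. Moving
  an end of a crossing edge from its side to the separating vertices does not increase the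
  order, and it can be done until no edge crosses, where the definition of connectedness
  applies, or until both sides are single vertices, where \<open>k + 1 \<le> card (verts G)\<close> suffices.

  The bound holds even when parallel edges are counted once. This gives room for one more in the
  case of parallel edges below.
\<close>

lemma simple_order_ge:
  assumes conn: "k_connected k G"
    and "separation (verts G) A B" "A \<noteq> {}" "B \<noteq> {}"
  shows "k \<le> sep_order (verts G) (\<lambda>a b. min 1 (mult G a b)) A B"
  using assms(2-)
proof (induction "card A + card B" arbitrary: A B rule: less_induct)
  case less
  let ?V = "verts G" and ?m = "\<lambda>a b. min 1 (mult G a b)"
  interpret multiplicities ?V ?m by (rule multiplicities_simple)
  have sub: "A \<subseteq> ?V" "B \<subseteq> ?V" "A \<inter> B = {}" using less.prems by (auto simp: separation_def)
  then have fin: "finite A" "finite B" using finite_sub by auto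
  have shrink: "k \<le> sep_order ?V ?m A' B'"
    if s: "separation ?V A' B'" and IH: "k \<le> sep_order ?V ?m A' (B' - {b})"
      and ab: "a \<in> A'" "b \<in> B'" "0 < mult G a b" for A' B' a b
  proof -
    have s': "separation ?V A' (B' - {b})" "b \<in> ?V - (A' \<union> (B' - {b}))" "insert b (B' - {b}) = B'"
      using s ab by (auto simp: separation_def)
    have "?m b a \<le> cross ?m {b} A'"
      using member_le_sum[of a A' "?m b"] ab s finite_sub[of A'] by (auto simp: cross_def separation_def)
    then have "1 \<le> cross ?m {b} A'" using ab sym[of a b] by simp
    then show ?thesis using order_insert[OF s'(1,2), unfolded s'(3)] IH by linarith
  qed
  show ?case
  proof (cases "\<exists>a\<in>A. \<exists>b\<in>B. 0 < mult G a b")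
    case False
    let ?T = "?V - (A \<union> B)"
    have "\<not> connected_graph (delete_verts G ?T)"
    proof
      assume con: "connected_graph (delete_verts G ?T)"
      obtain a b where ab: "a \<in> A" "b \<in> B" using less.prems by blast
      have "verts (delete_verts G ?T) = A \<union> B" using sub by (auto simp: delete_verts_def)
      then obtain p where p: "is_path_between (delete_verts G ?T) a p b"
        using con ab unfolding connected_graph_def by blast
      then have "path_verts p \<subseteq> A \<union> B"
        using \<open>verts _ = _\<close> by (auto simp: is_path_between_def is_path_def)
      moreover obtain e c d where "c \<in> A \<inter> path_verts p" "d \<in> path_verts p - A"
        "e \<in> edges (delete_verts G ?T)" "ends (delete_verts G ?T) e = {c, d}"
        using path_crosses[OF p, of A] ab sub by blast
      ultimately show False using False by (auto simp: delete_verts_def mult_pos_iff)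
    qed
    then have "k \<le> card ?T"
      using conn unfolding k_connected_def by (meson Diff_subset not_le)
    then show ?thesis by (simp add: sep_order_def)
  next
    case True
    then obtain a b where ab: "a \<in> A" "b \<in> B" "0 < mult G a b" by blast
    consider "B \<noteq> {b}" | "A \<noteq> {a}" | "A = {a}" "B = {b}" by blast
    then show ?thesis
    proof cases
      case 1
      have "card (B - {b}) < card B" using fin ab by (intro card_Diff1_less)
      moreover have "B - {b} \<noteq> {}" using 1 ab by blast
      ultimately have "k \<le> sep_order ?V ?m A (B - {b})"
        using less.prems sub by (intro less.hyps) (auto simp: separation_def)
      then show ?thesis using shrink less.prems(1) ab by blast
    next
      case 2
      have "card (A - {a}) < card A" using fin ab by (intro card_Diff1_less)
      moreover have "A - {a} \<noteq> {}" using 2 ab by blast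
      ultimately have "k \<le> sep_order ?V ?m (A - {a}) B"
        using less.prems sub by (intro less.hyps) (auto simp: separation_def)
      moreover have "0 < mult G b a" using ab by (simp add: mult_def insert_commute)
      moreover have "separation ?V B A" using less.prems(1) by (auto simp: separation_def)
      ultimately show ?thesis
        using shrink[of B A a b] ab order_commute[of A B] order_commute[of "A - {a}" B] by metis
    next
      case 3
      have "card (?V - {a, b}) = card ?V - 2"
        using 3 sub finite_V by (subst card_Diff_subset) auto
      moreover have "k + 1 \<le> card ?V" using conn by (simp add: k_connected_def)
      ultimately show ?thesis using ab by (simp add: sep_order_def cross_def 3 insert_commute)
    qed
  qed
qed

text \<open>
  Separations between the ends of two parallel edges contain both of them, hence exceed the
  order in the underlying simple graph.
\<close>

lemma locally_connected_if_parallel: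
  assumes conn: "k_connected k G" and uv: "u \<in> verts G" "v \<in> verts G" "2 \<le> mult G u v"
  shows "locally_connected (k + 1) (verts G) (mult G) u v"
  unfolding locally_connected_def
proof (intro allI impI)
  fix A B assume AB: "separation (verts G) A B" "u \<in> A" "v \<in> B"
  let ?m = "\<lambda>a b. min 1 (mult G a b)"
  have fin: "finite A" "finite B" using AB finite_verts finite_subset by (auto simp: separation_def)
  have "cross ?m A B < cross (mult G) A B"
    unfolding cross_def
  proof (rule sum_strict_mono_ex1[OF fin(1)])
    show "\<forall>a\<in>A. (\<Sum>b\<in>B. ?m a b) \<le> (\<Sum>b\<in>B. mult G a b)" by (auto intro: sum_mono)
    have "(\<Sum>b\<in>B. ?m u b) < (\<Sum>b\<in>B. mult G u b)"
      using AB(3) uv(3) by (intro sum_strict_mono_ex1[OF fin(2)] ballI bexI[of _ v]) auto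
    then show "\<exists>a\<in>A. (\<Sum>b\<in>B. ?m a b) < (\<Sum>b\<in>B. mult G a b)" using AB(2) by blast
  qed
  moreover have "k \<le> sep_order (verts G) ?m A B" using AB by (intro simple_order_ge[OF conn]) auto
  ultimately show "k + 1 \<le> sep_order (verts G) (mult G) A B" by (simp add: sep_order_def)
qed

text \<open>
  Menger's theorem for independent paths between two vertices. The edges joining \<open>u\<close> and \<open>v\<close>
  directly are paths of their own; they are used first, and the remaining \<open>r\<close> paths come from
  disjoint paths between the neighbourhoods of \<open>u\<close> and \<open>v\<close> in \<open>G - {u, v}\<close>. Here a separation
  with \<open>u \<in> A\<close> and \<open>v \<in> B\<close> has to be read off a set \<open>Z\<close> of vertices: \<open>A\<close> is \<open>Z\<close> with \<open>u\<close>, and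
  \<open>B\<close> is everything that is neither in \<open>A\<close> nor adjacent to it, together with \<open>v\<close>.
\<close>

theorem menger_independent_paths:
  assumes uv: "u \<in> verts G" "v \<in> verts G" "u \<noteq> v"
    and lc: "locally_connected n (verts G) (mult G) u v"
  shows "connected_by_independent_paths G n u v"
proof -
  let ?V = "verts G" and ?M = "{e \<in> edges G. ends G e = {u, v}}"
  define r where "r = n - mult G u v"
  define N where "N = ?V - {u, v}"
  define adj where "adj a b \<longleftrightarrow> (\<exists>e\<in>edges G. ends G e = {a, b})" for a b
  define X Y where "X = {a \<in> N. adj u a}" and "Y = {a \<in> N. adj a v}"
  define R where "R = {(a, b). a \<in> N \<and> b \<in> N \<and> adj a b}"
  have adj_0: "mult G a b = 0" if "\<not> adj a b" for a b
    using that mult_pos_iff[of a b] by (auto simp: adj_def)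
  \<comment> \<open>Only edges between \<open>u\<close> and \<open>v\<close> cross the separation belonging to \<open>Z\<close>.\<close>
  have cut: "r \<le> card (X \<union> R `` Z - Z)" if Z: "Z \<subseteq> N - Y" for Z
  proof -
    define A B where "A = insert u Z" and "B = ?V - (A \<union> X \<union> R `` Z)"
    have s: "separation ?V A B" "u \<in> A" "v \<in> B"
      using Z uv by (auto simp: separation_def A_def B_def N_def X_def R_def)
    have fin: "finite A" "finite B" using s finite_verts finite_subset by (auto simp: separation_def)
    have "mult G a b = (if a = u \<and> b = v then mult G u v else 0)" if "a \<in> A" "b \<in> B" for a b
    proof (cases "a = u \<and> b = v")
      case False
      have "\<not> adj a b" using that False Z by (auto simp: A_def B_def X_def R_def N_def Y_def)
      then show ?thesis using adj_0 False by auto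
    qed simp
    then have "cross (mult G) A B = (\<Sum>a\<in>A. \<Sum>b\<in>B. if a = u \<and> b = v then mult G u v else 0)"
      unfolding cross_def by (intro sum.cong) auto
    also have "\<dots> = (\<Sum>a\<in>A. if a = u then mult G u v else 0)"
      using fin s by (intro sum.cong) (auto simp: sum.delta)
    also have "\<dots> = mult G u v" using fin s by (simp add: sum.delta)
    finally have "cross (mult G) A B = mult G u v" .
    moreover have "?V - (A \<union> B) = X \<union> R `` Z - Z"
      using Z by (auto simp: A_def B_def X_def R_def N_def)
    moreover have "n \<le> sep_order ?V (mult G) A B" using lc s by (simp add: locally_connected_def)
    ultimately show ?thesis by (simp add: r_def sep_order_def)
  qed
  have "finite N" "X \<subseteq> N" "Y \<subseteq> N" "R \<subseteq> N \<times> N"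
    using finite_verts by (auto simp: N_def X_def Y_def R_def)
  then have "\<exists>p. (\<forall>i<r. p i \<noteq> [] \<and> distinct (p i) \<and> set (p i) \<subseteq> N \<and> hd (p i) \<in> X \<and> last (p i) \<in> Y \<and>
        successively (\<lambda>a b. (a, b) \<in> R) (p i)) \<and>
      (\<forall>i<r. \<forall>j<r. i \<noteq> j \<longrightarrow> set (p i) \<inter> set (p j) = {})"
    using cut by (rule menger_sets)
  then obtain p where "(\<forall>i<r. p i \<noteq> [] \<and> distinct (p i) \<and> set (p i) \<subseteq> N \<and> hd (p i) \<in> X \<and> last (p i) \<in> Y \<and>
        successively (\<lambda>a b. (a, b) \<in> R) (p i)) \<and>
      (\<forall>i<r. \<forall>j<r. i \<noteq> j \<longrightarrow> set (p i) \<inter> set (p j) = {})" ..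
  then have
    p: "\<And>i. i < r \<Longrightarrow> p i \<noteq> [] \<and> distinct (p i) \<and> set (p i) \<subseteq> N \<and> hd (p i) \<in> X \<and> last (p i) \<in> Y \<and>
          successively (\<lambda>a b. (a, b) \<in> R) (p i)"
    and disj: "\<And>i j. i < r \<Longrightarrow> j < r \<Longrightarrow> i \<noteq> j \<Longrightarrow> set (p i) \<inter> set (p j) = {}"
    by simp_all
  have "\<exists>es. is_path G (u # p i @ [v], es)" if "i < r" for i
  proof (rule exists_is_path)
    show "distinct (u # p i @ [v])" "set (u # p i @ [v]) \<subseteq> ?V"
      using p[OF that] uv by (auto simp: N_def)
    have "successively adj (p i)"
      using p[OF that] by (auto elim!: successively_mono simp: R_def)
    then have "successively adj (u # p i @ [v])"
      using p[OF that] by (auto simp: successively_Cons successively_append_iff X_def Y_def)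
    then show "successively (\<lambda>a b. \<exists>e\<in>edges G. ends G e = {a, b}) (u # p i @ [v])"
      by (simp add: adj_def[abs_def])
  qed simp
  then obtain es where es: "\<And>i. i < r \<Longrightarrow> is_path G (u # p i @ [v], es i)" by metis
  have "min n (mult G u v) \<le> card ?M" by (simp add: mult_def)
  then obtain M where M: "M \<subseteq> ?M" "card M = min n (mult G u v)" and finM: "finite M"
    by (rule obtain_subset_with_card_n)
  define long where "long = (\<lambda>i. (u # p i @ [v], es i))"
  define short where "short = (\<lambda>e :: 'e. ([u, v], [e]))"
  define P where "P = long ` {..<r} \<union> short ` M"
  have "inj_on long {..<r}"
  proof (rule inj_onI, rule ccontr)
    fix i j assume ij: "i \<in> {..<r}" "j \<in> {..<r}" "long i = long j" "i \<noteq> j"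
    then show False using disj[of i j] p[of i] by (auto simp: long_def)
  qed
  moreover have "inj_on short M" by (auto simp: inj_on_def short_def)
  moreover have "long ` {..<r} \<inter> short ` M = {}" using p by (auto simp: long_def short_def)
  ultimately have "card P = r + min n (mult G u v)"
    unfolding P_def using finM M by (subst card_Un_disjoint) (auto simp: card_image)
  then have "card P = n" by (simp add: r_def)
  moreover have "finite P" using finM by (simp add: P_def)
  moreover have between: "is_path_between G u q v" if "q \<in> P" for q
    using that es M uv
    by (auto simp: P_def long_def short_def is_path_between_def) 
       (auto simp: is_path_def path_verts_def path_edges_def)
  moreover have "independent P"
    unfolding independent_def
  proof (intro allI impI ballI)
    fix z q0
    assume "\<exists>q\<in>P. \<exists>q'\<in>P. q \<noteq> q' \<and> z \<in> path_verts q \<and> z \<in> path_verts q'" and "q0 \<in> P"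
    then have "z \<in> {u, v}"
      using disj unfolding P_def long_def short_def path_verts_def by fastforce
    then show "z \<in> path_endpoints q0"
      using between[OF \<open>q0 \<in> P\<close>] by (auto simp: is_path_between_def path_endpoints_def)
  qed
  ultimately show ?thesis
    unfolding connected_by_independent_paths_def by blast
qed

end

theorem theorem8:
  fixes G :: "('v, 'e) pre_multigraph" and k :: nat
  assumes "k \<in> {0, 1, 2, 3}"
    and "multigraph G"
    and "k_connected k G"
    and "\<exists>x \<in> verts G. \<exists>y \<in> verts G. x \<noteq> y \<and> connected_by_edge_disjoint_paths G (k + 1) x y"
  shows "\<exists>x \<in> verts G. \<exists>y \<in> verts G. x \<noteq> y \<and> connected_by_independent_paths G (k + 1) x y"
proof -
  interpret multigraph G by fact
  have "\<exists>u\<in>verts G. \<exists>v\<in>verts G. u \<noteq> v \<and> locally_connected (k + 1) (verts G) (mult G) u v"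
  proof (cases "\<exists>u\<in>verts G. \<exists>v\<in>verts G. u \<noteq> v \<and> 2 \<le> mult G u v")
    case True
    then show ?thesis using locally_connected_if_parallel[OF assms(3)] by blast
  next
    case False
    have simple: "mult G a b \<le> 1" if "a \<in> verts G" "b \<in> verts G" "a \<noteq> b" for a b
    proof -
      have "\<not> 2 \<le> mult G a b" using False that by blast
      then show ?thesis by simp
    qed
    interpret multiplicities "verts G" "mult G" by (rule multiplicities_mult)
    have "k_connected_multiplicities (verts G) (mult G) k"
    proof
      show "k \<le> 3" using assms(1) by auto
      show "mult G a b \<le> 1" if "a \<in> verts G" "b \<in> verts G" "a \<noteq> b" for a b
        using that by (rule simple)
      fix A B assume AB: "separation (verts G) A B" "A \<noteq> {}" "B \<noteq> {}"
      have "cross (\<lambda>a b. min 1 (mult G a b)) A B \<le> cross (mult G) A B"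
        unfolding cross_def by (intro sum_mono) simp
      then show "k \<le> sep_order (verts G) (mult G) A B"
        using simple_order_ge[OF assms(3) AB] by (simp add: sep_order_def)
    qed
    moreover obtain x y where "x \<in> verts G" "y \<in> verts G" "x \<noteq> y"
      and "connected_by_edge_disjoint_paths G (k + 1) x y"
      using assms(4) by blast
    moreover have "k < cross (mult G) X (verts G - X)" if "X \<subseteq> verts G" "x \<in> X" "y \<notin> X" for X
      using edge_disjoint_paths_le_cross[OF \<open>connected_by_edge_disjoint_paths G (k + 1) x y\<close> that] by simp
    ultimately show ?thesis by (intro exists_locally_connected) auto
  qed
  then show ?thesis using menger_independent_paths by blast
qed

end
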